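(* Let $\alpha>0$ and let $X_1,\ldots,X_n$ be i.i.d. random variables with the Gamma$(\alpha)$ distribution, i.e. with density $\Gamma(\alpha)^{-1}x^{\alpha-1}e^{-x}$ on $(0,\infty)$. Then for any integer $n\geq 1/\alpha$ and any nonnegative real numbers $d_1,\ldots,d_n$ satisfying $\sum_{i=1}^n d_i^2=1$ one has \[ h\Big(\sum_{i=1}^n d_iX_i\Big)\leq h\Big(\frac{1}{\sqrt n}\sum_{i=1}^n X_i\Big), \] with equality if and only if $d_1=\cdots=d_n=1/\sqrt n$.
   Context: For a real random variable $X$ with density $f$, its (Shannon differential) entropy is $h(X)=-\int f\ln f$, with the convention $0\ln 0=0$. *)

theory Defs
  imports "HOL-Probability.Probability"
begin

definition gamma_density :: "real \<Rightarrow> real \<Rightarrow> real" where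
  "gamma_density a x = (if 0 < x then x powr (a - 1) * exp (- x) / Gamma a else 0)"

end

theory Submission
  imports Defs
begin

text \<open>
  Write \<open>s\<close> for the sum of the weights and \<open>k = a s\<^sup>2\<close>. The Gamma law with shape \<open>k\<close> and rate \<open>s\<close>
  has the mean and the variance of the weighted sum \<open>S\<close>, and Cauchy--Schwarz gives \<open>k \<le> n a\<close> with
  equality only for equal weights. Cauchy--Schwarz, applied to the logarithmic derivatives,
  also shows that the Laplace transform of \<open>S\<close> is at most that of this Gamma law; since
  \<open>x powr -e\<close> is a mixture of the functions \<open>exp (- t x)\<close>, letting \<open>e\<close> tend to \<open>0\<close> yields
  \<open>E ln S \<ge> Digamma k - ln s\<close>. If \<open>k \<ge> 1\<close>, Gibbs' inequality against the Gamma law therefore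
  bounds the entropy of \<open>S\<close> by that of the Gamma law with shape \<open>k\<close> and variance \<open>a\<close>, which is
  strictly increasing in \<open>k \<ge> 1\<close> and at \<open>k = n a\<close> is the entropy for equal weights. If \<open>k < 1\<close>,
  Gibbs' inequality against an exponential law suffices, because \<open>n a \<ge> 1\<close>.
\<close>

section \<open>Gamma densities with a rate: mass, moments, Laplace transform, convolution\<close>

text \<open>The rate is a parameter because scaling a variable by \<open>c > 0\<close> keeps the
  shape and divides the rate by \<open>c\<close>, while independent summands with a common rate add
  their shapes.\<close>

definition gamma_rate_density :: "real \<Rightarrow> real \<Rightarrow> real \<Rightarrow> real" where
  "gamma_rate_density p l x =
     (if 0 < x then l powr p * x powr (p - 1) * exp (- (l * x)) / Gamma p else 0)"

lemma gamma_rate_density_nonneg: "0 < p \<Longrightarrow> 0 \<le> gamma_rate_density p l x"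
  by (auto simp: gamma_rate_density_def intro!: divide_nonneg_pos Gamma_real_pos)

lemma gamma_rate_density_pos: "0 < p \<Longrightarrow> 0 < l \<Longrightarrow> 0 < x \<Longrightarrow> 0 < gamma_rate_density p l x"
  by (auto simp: gamma_rate_density_def intro!: divide_pos_pos mult_pos_pos Gamma_real_pos)

lemma gamma_rate_density_eq_0: "x \<le> 0 \<Longrightarrow> gamma_rate_density p l x = 0"
  by (simp add: gamma_rate_density_def)

lemma measurable_gamma_rate_density [measurable]:
  "gamma_rate_density p l \<in> borel_measurable borel"
  unfolding gamma_rate_density_def[abs_def] by measurable

text \<open>Euler's integral for \<open>Gamma p\<close> under the substitution
  \<open>t = l * x\<close>.\<close>

lemma nn_integral_gamma_rate_density:
  assumes "0 < p" "0 < l"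
  shows "(\<integral>\<^sup>+x. ennreal (gamma_rate_density p l x) \<partial>lborel) = 1"
proof -
  have G: "0 < Gamma p" using assms by (simp add: Gamma_real_pos)
  \<comment> \<open>The indicator includes the endpoint \<open>x = 0\<close>, where the density is
    \<open>0\<close> by definition; both sides agree because \<open>0 powr (p - 1)\<close> is
    \<open>0\<close>.\<close>
  have eq: "ennreal (l / Gamma p * (indicator {0..} (l * x) * (l * x) powr (p - 1) / exp (l * x)))
      = ennreal (gamma_rate_density p l x)" for x
  proof (cases "0 < x")
    case True
    have "l * (l * x) powr (p - 1) = l powr p * x powr (p - 1)"
      using assms True powr_mult_base[of l "p - 1"] by (simp add: powr_mult)
    then show ?thesis using True assms
      by (simp add: gamma_rate_density_def exp_minus divide_inverse indicator_def)
  next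
    case False
    then have "x = 0 \<or> l * x < 0" using assms by (auto simp: mult_less_0_iff)
    then show ?thesis using False by (auto simp: gamma_rate_density_def)
  qed
  have "1 = ennreal (1 / Gamma p) * ennreal (Gamma p)"
    using G by (simp add: ennreal_mult[symmetric])
  also have "\<dots> = ennreal (1 / Gamma p)
      * (\<integral>\<^sup>+t. ennreal (indicator {0..} t * t powr (p - 1) / exp t) \<partial>lborel)"
    using assms by (simp add: Gamma_conv_nn_integral_real)
  also have "\<dots> = ennreal (1 / Gamma p) * (ennreal l
      * (\<integral>\<^sup>+x. ennreal (indicator {0..} (l * x) * (l * x) powr (p - 1) / exp (l * x)) \<partial>lborel))"
    using nn_integral_real_affine[of "\<lambda>t. ennreal (indicator {0..} t * t powr (p - 1) / exp t)" l 0]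
      assms by simp
  also have "\<dots> = (\<integral>\<^sup>+x. ennreal (1 / Gamma p) * (ennreal l
      * ennreal (indicator {0..} (l * x) * (l * x) powr (p - 1) / exp (l * x))) \<partial>lborel)"
    by (simp add: nn_integral_cmult)
  also have "\<dots> = (\<integral>\<^sup>+x. ennreal (gamma_rate_density p l x) \<partial>lborel)"
    using assms G by (intro nn_integral_cong) (simp add: ennreal_mult[symmetric] flip: eq)
  finally show ?thesis ..
qed

text \<open>A power factor only shifts the shape, just as an exponential factor only shifts the
  rate. Moments and Laplace transforms thus reduce to the total mass being \<open>1\<close>.\<close>

lemma gamma_rate_density_times_powr:
  assumes "0 < p" "0 < l" "0 < p + q"
  shows "gamma_rate_density p l x * x powr q =
    Gamma (p + q) / Gamma p * l powr (- q) * gamma_rate_density (p + q) l x"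
proof (cases "0 < x")
  case True
  have "0 < Gamma p" "0 < Gamma (p + q)" using assms by (simp_all add: Gamma_real_pos)
  moreover have "Gamma (p + q) \<noteq> 0" using calculation by linarith
  ultimately show ?thesis using True assms
    by (simp add: gamma_rate_density_def powr_diff powr_add powr_minus field_simps)
qed (simp add: gamma_rate_density_def)

lemma gamma_rate_density_times_exp:
  assumes "0 < p" "0 < l" "0 \<le> t"
  shows "gamma_rate_density p l x * exp (- (t * x)) =
    (l / (l + t)) powr p * gamma_rate_density p (l + t) x"
  using assms Gamma_real_pos[of p]
  by (auto simp: gamma_rate_density_def powr_divide field_simps simp flip: exp_add)

lemma nn_integral_gamma_rate_density_powr:
  assumes "0 < p" "0 < l" "0 < p + q"
  shows "(\<integral>\<^sup>+x. ennreal (gamma_rate_density p l x * x powr q) \<partial>lborel) =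
    ennreal (Gamma (p + q) / Gamma p * l powr (- q))"
proof -
  have "0 \<le> Gamma (p + q) / Gamma p * l powr (- q)"
    using assms Gamma_real_pos[of "p + q"] Gamma_real_pos[of p] by simp
  then show ?thesis
    unfolding gamma_rate_density_times_powr[OF assms]
    using assms by (simp add: ennreal_mult' nn_integral_cmult nn_integral_gamma_rate_density
        del: times_divide_eq_left)
qed

lemma nn_integral_gamma_rate_density_exp:
  assumes "0 < p" "0 < l" "0 \<le> t"
  shows "(\<integral>\<^sup>+x. ennreal (gamma_rate_density p l x * exp (- (t * x))) \<partial>lborel) =
    ennreal ((l / (l + t)) powr p)"
  using assms by (simp add: gamma_rate_density_times_exp ennreal_mult'
        nn_integral_cmult nn_integral_gamma_rate_density)

text \<open>A larger rate only makes the exponential smaller; the constant is the ratio of the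
  factors \<open>r powr p\<close> and \<open>l powr p\<close>. This brings summands with different
  rates under one rate, where convolution stays in the Gamma family.\<close>

lemma gamma_rate_density_le:
  assumes "0 < p" "0 < l" "l \<le> r"
  shows "gamma_rate_density p r x \<le> (r / l) powr p * gamma_rate_density p l x"
proof (cases "0 < x")
  case True
  have "l * x \<le> r * x" using assms True by (intro mult_right_mono) auto
  then have "r powr p * x powr (p - 1) * exp (- (r * x)) / Gamma p
      \<le> r powr p * x powr (p - 1) * exp (- (l * x)) / Gamma p"
    using assms Gamma_real_pos[of p] by (intro divide_right_mono mult_left_mono) auto
  also have "\<dots> = (r / l) powr p * (l powr p * x powr (p - 1) * exp (- (l * x)) / Gamma p)"
    using assms by (simp add: powr_divide)
  finally show ?thesis using True by (simp add: gamma_rate_density_def)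
qed (simp add: gamma_rate_density_def)

text \<open>With a common rate the exponentials multiply to a factor free of \<open>y\<close>, and
  \<open>y = x * t\<close> turns the rest into the Beta integral.\<close>

lemma convolution_gamma_rate_density:
  assumes pq: "0 < p" "0 < q" and l: "0 < l"
  shows "(\<integral>\<^sup>+y. ennreal (gamma_rate_density p l (x - y)) * ennreal (gamma_rate_density q l y) \<partial>lborel)
    = ennreal (gamma_rate_density (p + q) l x)"
proof (cases "0 < x")
  case False
  then have "gamma_rate_density p l (x - y) = 0 \<or> gamma_rate_density q l y = 0" for y
    by (simp add: gamma_rate_density_def)
  then have "ennreal (gamma_rate_density p l (x - y)) * ennreal (gamma_rate_density q l y) = 0" for y
    by (metis ennreal_0 mult_zero_left mult_zero_right)
  then show ?thesis using False
    by (simp only: gamma_rate_density_eq_0 not_less nn_integral_const) simp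
next
  case True
  note G = Gamma_real_pos[OF pq(1)] Gamma_real_pos[OF pq(2)]
  \<comment> \<open>All factors of the product at \<open>y = x * t\<close> that do not depend on
    \<open>t\<close>; the Jacobian \<open>x\<close> is kept apart.\<close>
  define K where "K = l powr (p + q) * x powr (p + q - 2) * exp (- (l * x)) / (Gamma p * Gamma q)"
  have K: "0 \<le> K" using G by (simp add: K_def)
  let ?b = "\<lambda>t. t powr (q - 1) * (1 - t) powr (p - 1)"
  have beta: "(\<integral>\<^sup>+t. ennreal (indicator {0..1} t * ?b t) \<partial>lborel) = ennreal (Beta q p)"
    using nn_integral_has_integral_lebesgue[OF _ has_integral_Beta_real[OF pq(2,1)]] by simp
  have eq: "ennreal (gamma_rate_density p l (x - x * t)) * ennreal (gamma_rate_density q l (x * t))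
      = ennreal K * ennreal (indicator {0..1} t * ?b t)" for t
  proof (cases "0 < t \<and> t < 1")
    case t: True
    have x1: "0 < x - x * t" "0 < x * t" using True t by auto
    have "x - x * t = x * (1 - t)" by (simp add: algebra_simps)
    then have 1: "gamma_rate_density p l (x - x * t)
        = l powr p * x powr (p - 1) * (1 - t) powr (p - 1) * exp (- (l * (x - x * t))) / Gamma p"
      using True t x1 by (simp add: gamma_rate_density_def powr_mult)
    have 2: "gamma_rate_density q l (x * t)
        = l powr q * x powr (q - 1) * t powr (q - 1) * exp (- (l * (x * t))) / Gamma q"
      using True t x1 by (simp add: gamma_rate_density_def powr_mult)
    have e: "exp (- (l * (x - x * t))) * exp (- (l * (x * t))) = exp (- (l * x))"
      by (simp add: algebra_simps flip: exp_add)
    have xp: "x powr (p - 1) * x powr (q - 1) = x powr (p + q - 2)"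
      by (simp add: algebra_simps flip: powr_add)
    have "gamma_rate_density p l (x - x * t) * gamma_rate_density q l (x * t)
       = (l powr p * l powr q) * (x powr (p - 1) * x powr (q - 1))
          * (exp (- (l * (x - x * t))) * exp (- (l * (x * t)))) / (Gamma p * Gamma q) * ?b t"
      unfolding 1 2 by simp
    also have "\<dots> = K * ?b t" unfolding e xp K_def by (simp add: powr_add)
    finally show ?thesis using t K pq
      by (simp add: ennreal_mult[symmetric] gamma_rate_density_nonneg)
  next
    case t: False
    \<comment> \<open>At the endpoints the indicator is \<open>1\<close>, but one of the powers has
      base \<open>0\<close> and so vanishes along with one of the densities.\<close>
    then have "t = 0 \<or> t = 1 \<or> t < 0 \<or> 1 < t" by auto
    moreover have "x * t \<le> 0 \<longleftrightarrow> t \<le> 0" "x - x * t \<le> 0 \<longleftrightarrow> 1 \<le> t"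
      using True by (auto simp: mult_le_0_iff)
    ultimately show ?thesis by (auto simp: gamma_rate_density_eq_0)
  qed
  have "(\<integral>\<^sup>+y. ennreal (gamma_rate_density p l (x - y)) * ennreal (gamma_rate_density q l y) \<partial>lborel)
      = ennreal x * (\<integral>\<^sup>+t. ennreal (gamma_rate_density p l (x - x * t))
          * ennreal (gamma_rate_density q l (x * t)) \<partial>lborel)"
    using True nn_integral_real_affine[of "\<lambda>y. ennreal (gamma_rate_density p l (x - y))
        * ennreal (gamma_rate_density q l y)" x 0] by simp
  also have "\<dots> = ennreal x * (ennreal K * ennreal (Beta q p))"
    unfolding eq by (simp add: nn_integral_cmult beta)
  also have "\<dots> = ennreal (x * (K * Beta q p))"
    using True K by (simp add: ennreal_mult')
  also have "x * (K * Beta q p) = gamma_rate_density (p + q) l x"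
  proof -
    have "x * x powr (p + q - 2) = x powr (p + q - 1)"
      using True by (simp add: powr_mult_base)
    then show ?thesis using True G
      by (simp add: K_def Beta_def gamma_rate_density_def field_simps)
  qed
  finally show ?thesis .
qed

section \<open>Negative moments from Laplace transforms\<close>

text \<open>For \<open>x > 0\<close>, \<open>x powr (- e)\<close> is the mixture of the functions
  \<open>exp (- (t * x))\<close> with weight \<open>t powr (e - 1) / Gamma e\<close>; all integrands
  are nonnegative, so the integrals may be exchanged.\<close>

lemma nn_integral_powr_eq_laplace:
  fixes f :: "real \<Rightarrow> real"
  assumes [measurable]: "f \<in> borel_measurable borel" and f0: "\<And>x. x \<le> 0 \<Longrightarrow> f x = 0"
    and nonneg: "\<And>x. 0 \<le> f x" and e: "0 < e"
  shows "(\<integral>\<^sup>+x. ennreal (f x * x powr (- e)) \<partial>lborel) =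
    (\<integral>\<^sup>+t. ennreal (indicator {0<..} t * t powr (e - 1) / Gamma e)
       * (\<integral>\<^sup>+x. ennreal (f x * exp (- (t * x))) \<partial>lborel) \<partial>lborel)"
proof -
  have G: "0 < Gamma e" using e by (rule Gamma_real_pos)
  have "ennreal (f x * x powr (- e)) = (\<integral>\<^sup>+t. ennreal (indicator {0<..} t * t powr (e - 1) / Gamma e)
      * ennreal (f x * exp (- (t * x))) \<partial>lborel)" for x
  proof (cases "0 < x")
    case True
    \<comment> \<open>The inserted factor is the mass \<open>1\<close> of the Gamma density in the
      variable \<open>t\<close> with rate \<open>x\<close>; its factor \<open>x powr e\<close>
      cancels \<open>x powr (- e)\<close>.\<close>
    have "ennreal (f x * x powr (- e))
        = ennreal (f x * x powr (- e)) * (\<integral>\<^sup>+t. ennreal (gamma_rate_density e x t) \<partial>lborel)"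
      using True e by (simp add: nn_integral_gamma_rate_density)
    also have "\<dots> = (\<integral>\<^sup>+t. ennreal (f x * x powr (- e)) * ennreal (gamma_rate_density e x t) \<partial>lborel)"
      by (simp add: nn_integral_cmult)
    also have "\<dots> = (\<integral>\<^sup>+t. ennreal (indicator {0<..} t * t powr (e - 1) / Gamma e)
        * ennreal (f x * exp (- (t * x))) \<partial>lborel)"
    proof (intro nn_integral_cong)
      fix t
      have "f x * x powr (- e) * gamma_rate_density e x t
          = indicator {0<..} t * t powr (e - 1) / Gamma e * (f x * exp (- (t * x)))"
        using True by (auto simp: gamma_rate_density_def powr_minus field_simps)
      then show "ennreal (f x * x powr (- e)) * ennreal (gamma_rate_density e x t) =
          ennreal (indicator {0<..} t * t powr (e - 1) / Gamma e) * ennreal (f x * exp (- (t * x)))"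
        using nonneg G e by (simp add: ennreal_mult[symmetric] gamma_rate_density_nonneg)
    qed
    finally show ?thesis .
  qed (simp add: f0)
  then have "(\<integral>\<^sup>+x. ennreal (f x * x powr (- e)) \<partial>lborel) =
      (\<integral>\<^sup>+x. (\<integral>\<^sup>+t. ennreal (indicator {0<..} t * t powr (e - 1) / Gamma e)
        * ennreal (f x * exp (- (t * x))) \<partial>lborel) \<partial>lborel)"
    by simp
  also have "\<dots> = (\<integral>\<^sup>+t. (\<integral>\<^sup>+x. ennreal (indicator {0<..} t * t powr (e - 1) / Gamma e)
        * ennreal (f x * exp (- (t * x))) \<partial>lborel) \<partial>lborel)"
    by (rule lborel_pair.Fubini') measurable
  finally show ?thesis by (simp add: nn_integral_cmult)
qed

text \<open>The mixing weight is nonnegative, so an inequality between Laplace transforms passes to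
  negative moments. The bound on the transform is that of the Gamma law with shape \<open>k\<close>
  and rate \<open>r\<close>, whose moment of order \<open>- e\<close> is finite because
  \<open>e < k\<close>.\<close>

lemma nn_integral_powr_le_of_laplace_le:
  fixes f :: "real \<Rightarrow> real"
  assumes [measurable]: "f \<in> borel_measurable borel" and f0: "\<And>x. x \<le> 0 \<Longrightarrow> f x = 0"
    and nonneg: "\<And>x. 0 \<le> f x" and e: "0 < e" "e < k" and r: "0 < r"
    and le: "\<And>t. 0 < t \<Longrightarrow>
      (\<integral>\<^sup>+x. ennreal (f x * exp (- (t * x))) \<partial>lborel) \<le> ennreal ((r / (r + t)) powr k)"
  shows "(\<integral>\<^sup>+x. ennreal (f x * x powr (- e)) \<partial>lborel) \<le> ennreal (Gamma (k - e) / Gamma k * r powr e)"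
proof -
  have k: "0 < k" using e by simp
  have "(\<integral>\<^sup>+x. ennreal (f x * x powr (- e)) \<partial>lborel)
      = (\<integral>\<^sup>+t. ennreal (indicator {0<..} t * t powr (e - 1) / Gamma e)
       * (\<integral>\<^sup>+x. ennreal (f x * exp (- (t * x))) \<partial>lborel) \<partial>lborel)"
    by (rule nn_integral_powr_eq_laplace) (use assms in auto)
  also have "\<dots> \<le> (\<integral>\<^sup>+t. ennreal (indicator {0<..} t * t powr (e - 1) / Gamma e)
       * (\<integral>\<^sup>+x. ennreal (gamma_rate_density k r x * exp (- (t * x))) \<partial>lborel) \<partial>lborel)"
  proof (intro nn_integral_mono)
    fix t
    show "ennreal (indicator {0<..} t * t powr (e - 1) / Gamma e)
       * (\<integral>\<^sup>+x. ennreal (f x * exp (- (t * x))) \<partial>lborel)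
      \<le> ennreal (indicator {0<..} t * t powr (e - 1) / Gamma e)
       * (\<integral>\<^sup>+x. ennreal (gamma_rate_density k r x * exp (- (t * x))) \<partial>lborel)"
      using le[of t] k r by (cases "0 < t")
        (auto intro!: mult_left_mono simp: nn_integral_gamma_rate_density_exp)
  qed
  also have "\<dots> = (\<integral>\<^sup>+x. ennreal (gamma_rate_density k r x * x powr (- e)) \<partial>lborel)"
    by (rule nn_integral_powr_eq_laplace[symmetric])
      (use k e in \<open>auto simp: gamma_rate_density_eq_0 gamma_rate_density_nonneg\<close>)
  also have "\<dots> = ennreal (Gamma (k - e) / Gamma k * r powr e)"
    using nn_integral_gamma_rate_density_powr[of k r "- e"] k r e by simp
  finally show ?thesis .
qed

text \<open>The inequality \<open>ln y \<le> y - 1\<close> at \<open>y = x\<close> controls large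
  \<open>x\<close>, and at \<open>y = x powr (- e)\<close> it controls small \<open>x\<close>. Both
  terms are powers, so Gamma moments make \<open>ln\<close> integrable.\<close>

lemma abs_ln_le_powr:
  fixes x e :: real
  assumes "0 < x" "0 < e"
  shows "\<bar>ln x\<bar> \<le> x powr 1 + x powr (- e) / e"
proof -
  have "ln x \<le> x - 1" using assms ln_le_minus_one by simp
  moreover have "- e * ln x \<le> x powr (- e) - 1"
    using assms ln_le_minus_one[of "x powr (- e)"] by (simp add: ln_powr)
  then have "- ln x \<le> x powr (- e) / e - 1 / e" using assms by (simp add: field_simps)
  then have "- ln x \<le> x powr (- e) / e" using assms by (smt (verit) divide_nonneg_pos)
  moreover have "0 \<le> x powr (- e) / e" using assms by simp
  moreover have "x powr 1 = x" using assms by simp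
  ultimately show ?thesis using assms unfolding abs_le_iff by linarith
qed

lemma integrable_powr_of_le_gamma_rate_density:
  fixes f :: "real \<Rightarrow> real"
  assumes [measurable]: "f \<in> borel_measurable borel" and nonneg: "\<And>x. 0 \<le> f x"
    and le: "\<And>x. f x \<le> C * gamma_rate_density p l x" and pl: "0 < p" "0 < l" and q: "0 < p + q"
  shows "integrable lborel (\<lambda>x. f x * x powr q)"
proof (rule Bochner_Integration.integrable_bound)
  show "integrable lborel (\<lambda>x. C * (gamma_rate_density p l x * x powr q))"
  proof (intro integrable_mult_right integrableI_nonneg)
    show "(\<integral>\<^sup>+ x. ennreal (gamma_rate_density p l x * x powr q) \<partial>lborel) < \<infinity>"
      using pl q by (simp add: nn_integral_gamma_rate_density_powr)
  qed (use pl in \<open>auto simp: gamma_rate_density_nonneg\<close>)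
  show "AE x in lborel. norm (f x * x powr q) \<le> norm (C * (gamma_rate_density p l x * x powr q))"
  proof (intro AE_I2)
    fix x
    have "f x * x powr q \<le> C * gamma_rate_density p l x * x powr q"
      by (intro mult_right_mono le) auto
    then show "norm (f x * x powr q) \<le> norm (C * (gamma_rate_density p l x * x powr q))"
      using nonneg[of x] unfolding real_norm_def mult.assoc
      by (smt (verit) mult_nonneg_nonneg powr_ge_zero)
  qed
qed auto

lemma ln_gamma_rate_density:
  assumes "0 < k" "0 < r" "0 < x"
  shows "ln (gamma_rate_density k r x) = k * ln r - ln (Gamma k) + (k - 1) * ln x - r * x"
proof -
  have G: "0 < Gamma k" using assms by (simp add: Gamma_real_pos)
  then have "Gamma k \<noteq> 0" by linarith
  show ?thesis
    using assms G by (simp add: gamma_rate_density_def ln_div ln_mult ln_powr \<open>Gamma k \<noteq> 0\<close>)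
qed

section \<open>Gibbs' inequality and logarithmic moments under domination by a Gamma density\<close>

context
  fixes f :: "real \<Rightarrow> real" and C p l :: real
  assumes f_meas [measurable]: "f \<in> borel_measurable borel" and f_nonneg: "\<And>x. 0 \<le> f x"
    and f_le: "\<And>x. f x \<le> C * gamma_rate_density p l x" and pl: "0 < p" "0 < l"
    and f_int: "(\<integral>\<^sup>+x. ennreal (f x) \<partial>lborel) = 1"
begin

lemma le_gamma_eq_0: "x \<le> 0 \<Longrightarrow> f x = 0"
  using f_le[of x] f_nonneg[of x] by (simp add: gamma_rate_density_eq_0)

lemma le_gamma_integrable: "integrable lborel f"
  using f_int by (intro integrableI_nonneg) (auto simp: f_nonneg)

lemma le_gamma_integral: "(\<integral>x. f x \<partial>lborel) = 1"
  using f_int by (subst integral_eq_nn_integral) (auto simp: f_nonneg)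

lemma le_gamma_integrable_mean: "integrable lborel (\<lambda>x. f x * x)"
proof -
  have "f x * x powr 1 = f x * x" for x
    using le_gamma_eq_0[of x] by (cases "0 < x") auto
  moreover have "integrable lborel (\<lambda>x. f x * x powr 1)"
    using integrable_powr_of_le_gamma_rate_density[of f C p l 1] f_nonneg f_le pl by fastforce
  ultimately show ?thesis by presburger
qed

lemma le_gamma_integrable_ln: "integrable lborel (\<lambda>x. f x * ln x)"
proof (rule Bochner_Integration.integrable_bound)
  \<comment> \<open>The order \<open>- (p / 2)\<close> is above \<open>- p\<close>, so the
    dominating Gamma law of shape \<open>p\<close> has this moment.\<close>
  show "integrable lborel (\<lambda>x. f x * x powr 1 + f x * x powr (- (p / 2)) / (p / 2))"
    using f_nonneg f_le pl
    by (intro Bochner_Integration.integrable_add integrable_divide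
        integrable_powr_of_le_gamma_rate_density[of f C p l]) auto
  show "AE x in lborel. norm (f x * ln x)
      \<le> norm (f x * x powr 1 + f x * x powr (- (p / 2)) / (p / 2))"
  proof (intro AE_I2)
    fix x
    show "norm (f x * ln x) \<le> norm (f x * x powr 1 + f x * x powr (- (p / 2)) / (p / 2))"
    proof (cases "0 < x")
      case True
      have "\<bar>f x * ln x\<bar> = f x * \<bar>ln x\<bar>" using f_nonneg[of x] by (simp add: abs_mult)
      also have "\<dots> \<le> f x * (x powr 1 + x powr (- (p / 2)) / (p / 2))"
        using True pl f_nonneg[of x] by (intro mult_left_mono abs_ln_le_powr) auto
      also have "\<dots> = f x * x powr 1 + f x * x powr (- (p / 2)) / (p / 2)"
        by (simp add: algebra_simps)
      finally show ?thesis by simp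
    qed (simp add: le_gamma_eq_0)
  qed
qed auto

text \<open>Gibbs' inequality: the right side is the cross entropy of \<open>f\<close> relative to
  the Gamma density with shape \<open>k\<close> and rate \<open>r\<close>, with the logarithm of
  that density expanded.\<close>

lemma le_gamma_entropy:
  assumes k: "0 < k" and r: "0 < r"
  shows "- (\<integral>x. f x * ln (f x) \<partial>lborel) \<le> ln (Gamma k) - k * ln r
      - (k - 1) * (\<integral>x. f x * ln x \<partial>lborel) + r * (\<integral>x. f x * x \<partial>lborel)"
proof -
  \<comment> \<open>For positive parameters this is \<open>f x\<close> times the logarithm of the
    Gamma density, in a form that is visibly integrable and vanishes wherever \<open>f\<close>
    does.\<close>
  define L where "L k r x = (k * ln r - ln (Gamma k)) * f x + (k - 1) * (f x * ln x) - r * (f x * x)"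
    for k r x :: real
  have L_int [simp]: "integrable lborel (L k r)" for k r
    unfolding L_def[abs_def]
    using le_gamma_integrable_ln le_gamma_integrable_mean le_gamma_integrable by auto
  have L_eq: "L k r x = f x * ln (gamma_rate_density k r x)" if "0 < k" "0 < r" "0 < x" for k r x
    using that by (simp add: L_def ln_gamma_rate_density algebra_simps)
  have g_int: "integrable lborel (gamma_rate_density k r)"
    using k r by (intro integrableI_nonneg)
      (auto simp: gamma_rate_density_nonneg nn_integral_gamma_rate_density)
  have g_1: "(\<integral>x. gamma_rate_density k r x \<partial>lborel) = 1"
    using k r by (subst integral_eq_nn_integral)
      (auto simp: gamma_rate_density_nonneg nn_integral_gamma_rate_density)
  \<comment> \<open>The inequality \<open>ln y \<le> y - 1\<close> at \<open>y = g / f x\<close>,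
    with \<open>g\<close> the reference density. After integration the terms \<open>f x\<close> and
    \<open>g\<close> cancel, both having mass \<open>1\<close>.\<close>
  have lower: "L k r x + f x - gamma_rate_density k r x \<le> f x * ln (f x)" for x
  proof (cases "f x = 0")
    case True
    then show ?thesis using k by (simp add: L_def gamma_rate_density_nonneg)
  next
    case False
    then have f: "0 < f x" and x: "0 < x"
      using f_nonneg[of x] le_gamma_eq_0[of x] by (simp, meson not_le)
    define g where "g = gamma_rate_density k r x"
    have g: "0 < g" using k r x by (simp add: g_def gamma_rate_density_pos)
    have "f x * ln (g / f x) \<le> f x * (g / f x - 1)"
      using f g by (intro mult_left_mono ln_le_minus_one) auto
    also have "\<dots> = g - f x" using f by (simp add: algebra_simps)
    finally have "f x * ln g - f x * ln (f x) \<le> g - f x"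
      using f g by (simp add: ln_div algebra_simps)
    then show ?thesis using k r x by (simp add: L_eq g_def)
  qed
  \<comment> \<open>The domination of \<open>f\<close> enters here; enclosed between two integrable
    functions, \<open>f x * ln (f x)\<close> is integrable.\<close>
  have upper: "f x * ln (f x) \<le> ln C * f x + L p l x" for x
  proof (cases "f x = 0")
    case False
    then have f: "0 < f x" and x: "0 < x"
      using f_nonneg[of x] le_gamma_eq_0[of x] by (simp, meson not_le)
    define g where "g = gamma_rate_density p l x"
    have g: "0 < g" using pl x by (simp add: g_def gamma_rate_density_pos)
    have fCg: "f x \<le> C * g" using f_le by (simp add: g_def)
    then have "0 < C * g" using f by linarith
    then have C: "0 < C" using g by (simp add: zero_less_mult_iff)
    have "f x * ln (f x) \<le> f x * ln (C * g)"
      using f fCg by (intro mult_left_mono) auto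
    then show ?thesis using pl x C g by (simp add: L_eq g_def ln_mult algebra_simps)
  qed (simp add: L_def)
  have int: "integrable lborel (\<lambda>x. f x * ln (f x))"
  proof (rule Bochner_Integration.integrable_bound)
    show "integrable lborel (\<lambda>x. \<bar>L k r x + f x - gamma_rate_density k r x\<bar> + \<bar>ln C * f x + L p l x\<bar>)"
      using g_int le_gamma_integrable by auto
    show "AE x in lborel. norm (f x * ln (f x))
      \<le> norm (\<bar>L k r x + f x - gamma_rate_density k r x\<bar> + \<bar>ln C * f x + L p l x\<bar>)"
    proof (intro AE_I2)
      fix x
      show "norm (f x * ln (f x))
        \<le> norm (\<bar>L k r x + f x - gamma_rate_density k r x\<bar> + \<bar>ln C * f x + L p l x\<bar>)"
        using lower[of x] upper[of x] unfolding real_norm_def by linarith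
    qed
  qed auto
  have "(\<integral>x. L k r x + f x - gamma_rate_density k r x \<partial>lborel) \<le> (\<integral>x. f x * ln (f x) \<partial>lborel)"
    using g_int le_gamma_integrable int lower by (intro integral_mono) auto
  also have "(\<integral>x. L k r x + f x - gamma_rate_density k r x \<partial>lborel) = (\<integral>x. L k r x \<partial>lborel)"
    using g_int le_gamma_integrable g_1 le_gamma_integral by simp
  also have "\<dots> = k * ln r - ln (Gamma k) + (k - 1) * (\<integral>x. f x * ln x \<partial>lborel)
      - r * (\<integral>x. f x * x \<partial>lborel)"
    unfolding L_def
    using le_gamma_integrable_ln le_gamma_integrable_mean le_gamma_integrable le_gamma_integral by simp
  finally show "- (\<integral>x. f x * ln (f x) \<partial>lborel) \<le> ln (Gamma k) - k * ln r
      - (k - 1) * (\<integral>x. f x * ln x \<partial>lborel) + r * (\<integral>x. f x * x \<partial>lborel)"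
    by simp
qed

text \<open>From \<open>- e * ln x \<le> x powr (- e) - 1\<close> and the bound on negative moments,
  the negated logarithmic moment is at most a difference quotient at \<open>0\<close>. Letting
  \<open>e\<close> decrease to \<open>0\<close> replaces the quotient by a derivative.\<close>

lemma integral_ln_ge_of_laplace_le:
  assumes k: "0 < k" and r: "0 < r"
    and le: "\<And>t. 0 < t \<Longrightarrow>
      (\<integral>\<^sup>+x. ennreal (f x * exp (- (t * x))) \<partial>lborel) \<le> ennreal ((r / (r + t)) powr k)"
  shows "Digamma k - ln r \<le> (\<integral>x. f x * ln x \<partial>lborel)"
proof -
  \<comment> \<open>The moment of order \<open>- e\<close> of the Gamma law with shape
    \<open>k\<close> and rate \<open>r\<close>.\<close>
  define h where "h e = Gamma (k - e) / Gamma k * r powr e" for e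
  have G: "0 < Gamma k" using k by (rule Gamma_real_pos)
  then have G0: "Gamma k \<noteq> 0" by linarith
  have nonpos: "k \<notin> \<int>\<^sub>\<le>\<^sub>0" using k by auto
  have "(h has_real_derivative (- Digamma k + ln r)) (at 0)"
    unfolding h_def[abs_def] using k r G nonpos
    by (auto intro!: derivative_eq_intros simp: G0 field_simps)
  then have lim: "((\<lambda>e. (h (0 + e) - h 0) / e) \<longlongrightarrow> - Digamma k + ln r) (at_right 0)"
    by (auto simp: DERIV_def intro: filterlim_mono[OF _ order_refl at_le])
  have h0: "h 0 = 1" using G r by (simp add: h_def)
  have bound: "- (\<integral>x. f x * ln x \<partial>lborel) \<le> (h (0 + e) - h 0) / e" if e: "0 < e" "e < k" for e
  proof -
    have nn: "(\<integral>\<^sup>+x. ennreal (f x * x powr (- e)) \<partial>lborel) \<le> ennreal (h e)"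
      unfolding h_def using e r le
      by (intro nn_integral_powr_le_of_laplace_le) (auto simp: f_nonneg le_gamma_eq_0)
    have int: "integrable lborel (\<lambda>x. f x * x powr (- e))"
      using nn by (intro integrableI_nonneg) (auto simp: f_nonneg intro: le_less_trans)
    have "ennreal (\<integral>x. f x * x powr (- e) \<partial>lborel) \<le> ennreal (h e)"
      using nn int by (subst nn_integral_eq_integral[symmetric]) (auto simp: f_nonneg)
    then have le_h: "(\<integral>x. f x * x powr (- e) \<partial>lborel) \<le> h e"
      using G r e Gamma_real_pos[of "k - e"] by (subst (asm) ennreal_le_iff) (auto simp: h_def)
    have "(\<integral>x. - e * (f x * ln x) \<partial>lborel) \<le> (\<integral>x. f x * x powr (- e) - f x \<partial>lborel)"
    proof (intro integral_mono)
      fix x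
      show "- e * (f x * ln x) \<le> f x * x powr (- e) - f x"
      proof (cases "0 < x")
        case True
        then have "- e * ln x \<le> x powr (- e) - 1"
          using ln_le_minus_one[of "x powr (- e)"] by (simp add: ln_powr)
        then have "f x * (- e * ln x) \<le> f x * (x powr (- e) - 1)"
          by (intro mult_left_mono f_nonneg)
        then show ?thesis by (simp add: algebra_simps)
      qed (simp add: le_gamma_eq_0)
    qed (use int le_gamma_integrable le_gamma_integrable_ln in auto)
    also have "\<dots> = (\<integral>x. f x * x powr (- e) \<partial>lborel) - 1"
      using int le_gamma_integrable le_gamma_integral by simp
    finally have "- e * (\<integral>x. f x * ln x \<partial>lborel) \<le> h e - 1" using le_h by simp
    then show ?thesis using e by (simp add: h0 field_simps)
  qed
  have "- (\<integral>x. f x * ln x \<partial>lborel) \<le> - Digamma k + ln r"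
  proof (rule tendsto_lowerbound[OF lim])
    show "\<forall>\<^sub>F e in at_right 0. - (\<integral>x. f x * ln x \<partial>lborel) \<le> (h (0 + e) - h 0) / e"
      unfolding eventually_at_right_field using k bound by (intro exI[of _ k]) auto
  qed simp
  then show ?thesis by simp
qed

end

text \<open>The same limit with moments of positive order \<open>e\<close>, which for the Gamma law
  are known exactly. This direction serves to bound the entropy of the equal-weight sum from
  below.\<close>

lemma integral_ln_gamma_rate_density_le:
  assumes k: "0 < k" and r: "0 < r"
  shows "(\<integral>x. gamma_rate_density k r x * ln x \<partial>lborel) \<le> Digamma k - ln r"
proof -
  let ?f = "gamma_rate_density k r"
  define h where "h e = Gamma (k + e) / Gamma k * r powr (- e)" for e
  have G: "0 < Gamma k" using k by (rule Gamma_real_pos)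
  then have G0: "Gamma k \<noteq> 0" by linarith
  have nonpos: "k \<notin> \<int>\<^sub>\<le>\<^sub>0" using k by auto
  have "(h has_real_derivative (Digamma k - ln r)) (at 0)"
    unfolding h_def[abs_def] using k r G nonpos
    by (auto intro!: derivative_eq_intros simp: G0 field_simps)
  then have lim: "((\<lambda>e. (h (0 + e) - h 0) / e) \<longlongrightarrow> Digamma k - ln r) (at_right 0)"
    by (auto simp: DERIV_def intro: filterlim_mono[OF _ order_refl at_le])
  have h0: "h 0 = 1" using G r by (simp add: h_def)
  \<comment> \<open>A Gamma density is dominated by itself with constant \<open>1\<close>, which
    makes the integrability results for dominated densities available.\<close>
  have le_self: "?f x \<le> 1 * ?f x" for x by simp
  note facts = measurable_gamma_rate_density gamma_rate_density_nonneg[OF k] le_self k r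
    nn_integral_gamma_rate_density[OF k r]
  have bound: "(\<integral>x. ?f x * ln x \<partial>lborel) \<le> (h (0 + e) - h 0) / e" if e: "0 < e" for e
  proof -
    have int: "integrable lborel (\<lambda>x. ?f x * x powr e)"
      using integrable_powr_of_le_gamma_rate_density[OF facts(1-5)] k e by simp
    have "(\<integral>x. e * (?f x * ln x) \<partial>lborel) \<le> (\<integral>x. ?f x * x powr e - ?f x \<partial>lborel)"
    proof (intro integral_mono)
      fix x
      show "e * (?f x * ln x) \<le> ?f x * x powr e - ?f x"
      proof (cases "0 < x")
        case True
        then have "e * ln x \<le> x powr e - 1"
          using ln_le_minus_one[of "x powr e"] by (simp add: ln_powr)
        then have "?f x * (e * ln x) \<le> ?f x * (x powr e - 1)"
          by (intro mult_left_mono facts)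
        then show ?thesis by (simp add: algebra_simps)
      qed (simp add: gamma_rate_density_eq_0)
    qed (use int le_gamma_integrable[OF facts] le_gamma_integrable_ln[OF facts] in auto)
    also have "\<dots> = (\<integral>x. ?f x * x powr e \<partial>lborel) - 1"
      using int le_gamma_integrable[OF facts] le_gamma_integral[OF facts] by simp
    also have "(\<integral>x. ?f x * x powr e \<partial>lborel) = h e"
    proof -
      have "0 < Gamma (k + e)" using k e by (simp add: Gamma_real_pos)
      then have h_nonneg: "0 \<le> h e" using G by (simp add: h_def)
      have nn: "(\<integral>\<^sup>+x. ennreal (?f x * x powr e) \<partial>lborel) = ennreal (h e)"
        using k r e by (simp add: nn_integral_gamma_rate_density_powr h_def)
      have "(\<integral>x. ?f x * x powr e \<partial>lborel) = enn2real (\<integral>\<^sup>+x. ennreal (?f x * x powr e) \<partial>lborel)"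
        by (intro integral_eq_nn_integral) (auto simp: facts)
      also have "\<dots> = h e"
        unfolding nn using h_nonneg by (rule enn2real_ennreal)
      finally show ?thesis .
    qed
    finally show ?thesis
      using e by (simp add: h0 field_simps)
  qed
  show ?thesis
  proof (rule tendsto_lowerbound[OF lim])
    show "\<forall>\<^sub>F e in at_right 0. (\<integral>x. ?f x * ln x \<partial>lborel) \<le> (h (0 + e) - h 0) / e"
      unfolding eventually_at_right_field using bound by (intro exI[of _ 1]) auto
  qed simp
qed

section \<open>A trigamma bound and the monotonicity of the standardized Gamma entropy\<close>

text \<open>The trigamma series has the terms \<open>1 / y\<^sup>2\<close> with
  \<open>y = k + real j\<close>; each is smaller than \<open>1 / (y\<^sup>2 - 1)\<close>, and the
  series of these telescopes.\<close>

lemma trigamma_real_less: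
  fixes k :: real
  assumes k: "1 < k"
  shows "Polygamma 1 k < (1 / k + 1 / (k - 1)) / 2"
proof -
  \<comment> \<open>Averaging two neighbouring reciprocals makes the middle one cancel in
    \<open>u j - u (Suc j)\<close>, which leaves exactly \<open>1 / (y\<^sup>2 - 1)\<close>.\<close>
  define u where "u j = (1 / (k + real j) + 1 / (k + real j - 1)) / 2" for j :: nat
  have "u \<longlonglongrightarrow> 0" unfolding u_def by real_asymp
  from telescope_sums'[OF this]
  have u: "(\<lambda>j. u j - u (Suc j)) sums ((1 / k + 1 / (k - 1)) / 2)" by (simp add: u_def)
  have p: "(\<lambda>j. inverse ((k + real j)\<^sup>2)) sums Polygamma 1 k"
    using Polygamma_LIMSEQ[of k 1] k by (simp add: numeral_2_eq_2)
  have pos: "0 < u j - u (Suc j) - inverse ((k + real j)\<^sup>2)" for j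
  proof -
    define y where "y = k + real j"
    have y: "1 < y" using k by (simp add: y_def)
    have "u j - u (Suc j) = (1 / (y - 1) - 1 / (y + 1)) / 2"
      by (simp add: u_def y_def add_ac add_divide_distrib diff_divide_distrib)
    also have "\<dots> = 1 / (y\<^sup>2 - 1)"
    proof -
      have "y\<^sup>2 - 1 = (y - 1) * (y + 1)" by (simp add: power2_eq_square algebra_simps)
      moreover have "1 / (y - 1) - 1 / (y + 1) = 2 / ((y - 1) * (y + 1))"
        using y by (simp add: field_simps)
      ultimately show ?thesis by simp
    qed
    also have "inverse (y\<^sup>2) < \<dots>"
      unfolding inverse_eq_divide using y by (intro divide_strict_left_mono) auto
    finally show ?thesis by (simp add: y_def)
  qed
  have D: "(\<lambda>j. u j - u (Suc j) - inverse ((k + real j)\<^sup>2)) sums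
      ((1 / k + 1 / (k - 1)) / 2 - Polygamma 1 k)"
    by (rule sums_diff[OF u p])
  show ?thesis
    using suminf_pos[OF sums_summable[OF D] pos] unfolding sums_unique[OF D, symmetric] by simp
qed

text \<open>The entropy of the Gamma law with shape \<open>k\<close>, rescaled to variance \<open>1\<close>.\<close>
definition gamma_std_entropy :: "real \<Rightarrow> real" where
  "gamma_std_entropy k = k + ln (Gamma k) + (1 - k) * Digamma k - ln k / 2"

text \<open>In the derivative the two \<open>Digamma\<close> terms cancel, and the trigamma bound is
  what makes the remainder positive for \<open>x > 1\<close>.\<close>

lemma gamma_std_entropy_strict_mono:
  assumes "1 \<le> k" "k < k'"
  shows "gamma_std_entropy k < gamma_std_entropy k'"
proof (rule DERIV_pos_imp_increasing[OF assms(2)])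
  fix x :: real assume "k \<le> x" "x \<le> k'"
  then have x: "1 \<le> x" using assms by simp
  then have G: "0 < Gamma x" and nonpos: "x \<notin> \<int>\<^sub>\<le>\<^sub>0" by (auto simp: Gamma_real_pos)
  then have G0: "Gamma x \<noteq> 0" by linarith
  have "(gamma_std_entropy has_real_derivative
      1 + (1 - x) * Polygamma 1 x - 1 / (2 * x)) (at x)"
    unfolding gamma_std_entropy_def[abs_def] using x G nonpos
    by (auto intro!: derivative_eq_intros simp: G0 field_simps)
  moreover have "0 < 1 + (1 - x) * Polygamma 1 x - 1 / (2 * x)"
  \<comment> \<open>At \<open>x = 1\<close> the trigamma term has coefficient \<open>0\<close> and
    the derivative equals \<open>1 / 2\<close>.\<close>
  proof (cases "x = 1")
    case False
    then have x: "1 < x" using x by simp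
    have "(x - 1) * Polygamma 1 x < (x - 1) * ((1 / x + 1 / (x - 1)) / 2)"
      using x trigamma_real_less[OF x] by (intro mult_strict_left_mono) auto
    also have "\<dots> = 1 - 1 / (2 * x)" using x by (simp add: field_simps)
    finally show ?thesis by (simp add: algebra_simps)
  qed simp
  ultimately show "\<exists>y. (gamma_std_entropy has_real_derivative y) (at x) \<and> 0 < y" by blast
qed

section \<open>Comparison of Laplace transforms by Cauchy--Schwarz\<close>

text \<open>Both sides vanish at \<open>t = 0\<close>, so it suffices to compare derivatives. There
  the claim is that \<open>s\<^sup>2 / (s + u)\<close> is at most the sum of
  \<open>c i / (1 + c i * u)\<close>, and \<open>s + u\<close> is the sum of
  \<open>c i * (1 + c i * u)\<close>.\<close>

lemma sum_ln_one_plus_ge: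
  fixes c :: "'i \<Rightarrow> real"
  assumes c: "\<And>i. i \<in> I \<Longrightarrow> 0 \<le> c i" and sq: "(\<Sum>i\<in>I. (c i)\<^sup>2) = 1"
    and s: "s = (\<Sum>i\<in>I. c i)" "0 < s" and t: "0 \<le> t"
  shows "s\<^sup>2 * ln (1 + t / s) \<le> (\<Sum>i\<in>I. ln (1 + c i * t))"
proof -
  let ?g = "\<lambda>t. (\<Sum>i\<in>I. ln (1 + c i * t)) - s\<^sup>2 * ln (1 + t / s)"
  have "?g 0 \<le> ?g t"
  proof (rule DERIV_nonneg_imp_nondecreasing[OF t])
    fix u :: real assume u: "0 \<le> u" "u \<le> t"
    have pos: "0 < 1 + c i * u" if "i \<in> I" for i
      using c[OF that] u by (simp add: add_pos_nonneg)
    have su: "0 < 1 + u / s" using s u by (simp add: add_pos_nonneg)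
    have "(?g has_real_derivative (\<Sum>i\<in>I. c i / (1 + c i * u)) - s\<^sup>2 * ((1 / s) / (1 + u / s))) (at u)"
      using pos su s by (auto intro!: derivative_eq_intros)
    moreover have "s\<^sup>2 * ((1 / s) / (1 + u / s)) \<le> (\<Sum>i\<in>I. c i / (1 + c i * u))"
    proof -
      define v where "v = s / (s + u)"
      \<comment> \<open>Cauchy--Schwarz, in the form of the tangent to the reciprocal at the weighted mean
        \<open>1 / v\<close> of the numbers \<open>1 + c i * u\<close>\<close>
      have tangent: "c i * (2 * v - v\<^sup>2 * (1 + c i * u)) \<le> c i * (1 / (1 + c i * u))" if "i \<in> I" for i
      proof (rule mult_left_mono)
        define w where "w = 1 + c i * u"
        have w: "0 < w" using pos[OF that] by (simp add: w_def)
        have "0 \<le> (v * w - 1)\<^sup>2 / w" using w by simp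
        also have "\<dots> = v\<^sup>2 * w - 2 * v + 1 / w" using w by (simp add: power2_eq_square field_simps)
        finally show "2 * v - v\<^sup>2 * (1 + c i * u) \<le> 1 / (1 + c i * u)" by (simp add: w_def)
      qed (use c that in auto)
      have "s\<^sup>2 * ((1 / s) / (1 + u / s)) = 2 * v * s - v\<^sup>2 * (s + u)"
      proof -
        have "v * (s + u) = s" using s u by (simp add: v_def)
        then have "v\<^sup>2 * (s + u) = v * s" by (simp add: power2_eq_square mult.assoc)
        moreover have "s\<^sup>2 * ((1 / s) / (1 + u / s)) = v * s"
          using s u by (simp add: v_def power2_eq_square field_simps)
        ultimately show ?thesis by simp
      qed
      also have "\<dots> = (\<Sum>i\<in>I. c i * (2 * v - v\<^sup>2 * (1 + c i * u)))"
      proof -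
        have "(\<Sum>i\<in>I. c i * (2 * v - v\<^sup>2 * (1 + c i * u)))
            = (\<Sum>i\<in>I. (2 * v - v\<^sup>2) * c i - v\<^sup>2 * u * (c i)\<^sup>2)"
          by (intro sum.cong) (auto simp: power2_eq_square algebra_simps)
        also have "\<dots> = (2 * v - v\<^sup>2) * s - v\<^sup>2 * u"
          by (simp add: sum_subtractf s(1) sq flip: sum_distrib_left)
        finally show ?thesis by (simp add: algebra_simps)
      qed
      also have "\<dots> \<le> (\<Sum>i\<in>I. c i * (1 / (1 + c i * u)))"
        by (intro sum_mono tangent)
      finally show ?thesis by simp
    qed
    ultimately show "\<exists>y. (?g has_real_derivative y) (at u) \<and> 0 \<le> y"
      by (intro exI conjI) auto
  qed
  then show ?thesis by simp
qed

text \<open>The left side is the Laplace transform of the weighted sum of independent Gamma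
  variables of shape \<open>a\<close>, the right side that of the Gamma law with shape
  \<open>a * s\<^sup>2\<close> and rate \<open>s\<close>. Taking logarithms gives the preceding
  inequality multiplied by \<open>- a\<close>.\<close>

lemma prod_laplace_le:
  fixes c :: "'i \<Rightarrow> real"
  assumes fin: "finite I" and c: "\<And>i. i \<in> I \<Longrightarrow> 0 \<le> c i" and sq: "(\<Sum>i\<in>I. (c i)\<^sup>2) = 1"
    and s: "s = (\<Sum>i\<in>I. c i)" "0 < s" and t: "0 \<le> t" and a: "0 \<le> a"
  shows "(\<Prod>i\<in>I. (1 / (1 + c i * t)) powr a) \<le> (s / (s + t)) powr (a * s\<^sup>2)"
proof -
  have pos: "0 < 1 + c i * t" if "i \<in> I" for i
    using c[OF that] t by (simp add: add_pos_nonneg)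
  have "(\<Prod>i\<in>I. (1 / (1 + c i * t)) powr a) = (\<Prod>i\<in>I. exp (- (a * ln (1 + c i * t))))"
    using pos by (intro prod.cong refl) (simp add: powr_def ln_div less_imp_neq[symmetric])
  also have "\<dots> = exp (- (a * (\<Sum>i\<in>I. ln (1 + c i * t))))"
    using fin by (simp add: exp_sum sum_negf sum_distrib_left flip: sum_negf)
  also have "\<dots> \<le> exp (- (a * (s\<^sup>2 * ln (1 + t / s))))"
    using sum_ln_one_plus_ge[OF c sq s t] a by (simp add: mult_left_mono)
  also have "\<dots> = (s / (s + t)) powr (a * s\<^sup>2)"
  proof -
    have "1 + t / s = (s + t) / s" using s by (simp add: field_simps)
    then have "ln (1 + t / s) = - ln (s / (s + t))" using s t by (simp add: ln_div)
    then show ?thesis using s t by (simp add: powr_def)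
  qed
  finally show ?thesis .
qed

section \<open>Densities of weighted sums of independent Gamma variables\<close>

context prob_space
begin

lemma distributed_cmult_gamma_density:
  assumes D: "distributed M lborel X (\<lambda>x. ennreal (gamma_density a x))" and c: "0 < c"
  shows "distributed M lborel (\<lambda>\<omega>. c * X \<omega>) (\<lambda>x. ennreal (gamma_rate_density a (1 / c) x))"
proof -
  have "ennreal (gamma_density a ((x - 0) / c)) / ennreal \<bar>c\<bar>
      = ennreal (gamma_rate_density a (1 / c) x)" for x
  proof (cases "0 < x")
    case True
    have "gamma_density a (x / c) / c = gamma_rate_density a (1 / c) x"
      using True c by (simp add: gamma_density_def gamma_rate_density_def powr_divide powr_diff)
    then have "ennreal (gamma_rate_density a (1 / c) x) = ennreal (gamma_density a (x / c) * inverse c)"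
      by (simp add: divide_inverse)
    also have "\<dots> = ennreal (gamma_density a (x / c)) * ennreal (inverse c)"
      using c by (intro ennreal_mult'') simp
    finally show ?thesis using c by (simp add: divide_ennreal_def inverse_ennreal)
  next
    case False
    then show ?thesis using c by (simp add: gamma_density_def gamma_rate_density_def zero_less_divide_iff)
  qed
  then show ?thesis
    using distributed_affine[OF D, of c 0] c by simp
qed

lemma distributed_sum_gamma:
  assumes "finite I" "I \<noteq> {}" and l: "0 < l" and a: "0 < a"
    and "indep_vars (\<lambda>_. borel) Y I"
    and "\<And>i. i \<in> I \<Longrightarrow> distributed M lborel (Y i) (\<lambda>x. ennreal (gamma_rate_density a l x))"
  shows "distributed M lborel (\<lambda>\<omega>. \<Sum>i\<in>I. Y i \<omega>)
    (\<lambda>x. ennreal (gamma_rate_density (real (card I) * a) l x))"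
  using assms
proof (induct rule: finite_ne_induct)
  case (singleton i)
  then show ?case by simp
next
  case (insert i I)
  have "0 < real (card I) * a" using insert a by (simp add: card_gt_0_iff)
  moreover have "distributed M lborel (\<lambda>\<omega>. Y i \<omega> + (\<Sum>i\<in>I. Y i \<omega>))
      (\<lambda>x. \<integral>\<^sup>+y. ennreal (gamma_rate_density a l (x - y))
        * ennreal (gamma_rate_density (real (card I) * a) l y) \<partial>lborel)"
    using insert by (intro distributed_convolution indep_vars_sum)
      (auto intro: indep_vars_subset)
  ultimately have "distributed M lborel (\<lambda>\<omega>. Y i \<omega> + (\<Sum>i\<in>I. Y i \<omega>))
      (\<lambda>x. ennreal (gamma_rate_density (a + real (card I) * a) l x))"
    using a l by (simp add: convolution_gamma_rate_density)
  then show ?case using insert by (simp add: algebra_simps)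
qed

text \<open>The domination by a Gamma density makes the entropy integrand of the sum integrable; otherwise
  the Bochner integral defining the entropy would silently be \<open>0\<close>.\<close>
lemma distributed_sum_le_gamma:
  assumes "finite I" "I \<noteq> {}" and l: "0 < l" and a: "0 < a"
    and "indep_vars (\<lambda>_. borel) Y I" and "\<And>i. i \<in> I \<Longrightarrow> l \<le> r i"
    and "\<And>i. i \<in> I \<Longrightarrow> distributed M lborel (Y i) (\<lambda>x. ennreal (gamma_rate_density a (r i) x))"
  shows "\<exists>f C. distributed M lborel (\<lambda>\<omega>. \<Sum>i\<in>I. Y i \<omega>) (\<lambda>x. ennreal (f x))
    \<and> (\<forall>x. 0 \<le> f x \<and> f x \<le> C * gamma_rate_density (real (card I) * a) l x) \<and> 0 \<le> C"
  using assms
proof (induct rule: finite_ne_induct)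
  case (singleton i)
  then show ?case
    by (intro exI[of _ "gamma_rate_density a (r i)"] exI[of _ "(r i / l) powr a"])
      (auto simp: gamma_rate_density_nonneg gamma_rate_density_le)
next
  case (insert i I)
  let ?n = "real (card I) * a"
  obtain f C where f: "distributed M lborel (\<lambda>\<omega>. \<Sum>i\<in>I. Y i \<omega>) (\<lambda>x. ennreal (f x))"
      "\<And>x. 0 \<le> f x" "\<And>x. f x \<le> C * gamma_rate_density ?n l x" "0 \<le> C"
    using insert.hyps(4)[OF l a indep_vars_subset[OF insert.prems(3)]] insert.prems by blast
  define F where "F x = (\<integral>\<^sup>+y. ennreal (gamma_rate_density a (r i) (x - y)) * ennreal (f y) \<partial>lborel)" for x
  \<comment> \<open>Passing from rate \<open>r i\<close> to the common rate \<open>l\<close> costs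
    the factor \<open>(r i / l) powr a\<close>; such factors multiply over the summands while the
    shapes add.\<close>
  define C' where "C' = (r i / l) powr a * C"
  have n: "0 < ?n" using insert a by (simp add: card_gt_0_iff)
  have C': "0 \<le> C'" using f by (simp add: C'_def)
  have D: "distributed M lborel (\<lambda>\<omega>. Y i \<omega> + (\<Sum>i\<in>I. Y i \<omega>)) F"
    unfolding F_def using insert f by (intro distributed_convolution indep_vars_sum) auto
  have F_le: "F x \<le> ennreal (C' * gamma_rate_density (a + ?n) l x)" for x
  proof -
    have "F x \<le> (\<integral>\<^sup>+y. ennreal C' * (ennreal (gamma_rate_density a l (x - y))
        * ennreal (gamma_rate_density ?n l y)) \<partial>lborel)"
      unfolding F_def
    proof (intro nn_integral_mono)
      fix y
      have "gamma_rate_density a (r i) (x - y) * f y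
          \<le> ((r i / l) powr a * gamma_rate_density a l (x - y)) * (C * gamma_rate_density ?n l y)"
        using insert l a f by (intro mult_mono gamma_rate_density_le) (auto simp: gamma_rate_density_nonneg)
      also have "\<dots> = C' * (gamma_rate_density a l (x - y) * gamma_rate_density ?n l y)"
        by (simp add: C'_def)
      finally show "ennreal (gamma_rate_density a (r i) (x - y)) * ennreal (f y)
        \<le> ennreal C' * (ennreal (gamma_rate_density a l (x - y)) * ennreal (gamma_rate_density ?n l y))"
        using a n f C' by (simp add: gamma_rate_density_nonneg ennreal_leI flip: ennreal_mult)
    qed
    also have "\<dots> = ennreal (C' * gamma_rate_density (a + ?n) l x)"
      using C' a n l by (simp add: nn_integral_cmult convolution_gamma_rate_density ennreal_mult')
    finally show ?thesis .
  qed
  have nonneg: "0 \<le> C' * gamma_rate_density (a + ?n) l x" for x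
    using C' a n by (simp add: gamma_rate_density_nonneg)
  \<comment> \<open>The convolution lies below a real bound, hence is finite everywhere and may be
    read as a real density.\<close>
  have fin: "ennreal (enn2real (F x)) = F x" for x
    using F_le[of x] by (simp add: ennreal_enn2real_if top_unique)
      (metis ennreal_less_top leD)
  have le: "enn2real (F x) \<le> C' * gamma_rate_density (a + ?n) l x" for x
    using enn2real_mono[OF F_le[of x]] nonneg[of x] by simp
  have "a + ?n = real (card (insert i I)) * a" using insert by (simp add: algebra_simps)
  with D fin le C' show ?case using insert
    by (intro exI[of _ "\<lambda>x. enn2real (F x)"] exI[of _ C']) simp
qed

end

lemma integral_gamma_rate_density_mean:
  assumes p: "0 < p" "0 < l"
  shows "integrable lborel (\<lambda>x. gamma_rate_density p l x * x)"
    and "(\<integral>x. gamma_rate_density p l x * x \<partial>lborel) = p / l"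
proof -
  have G: "0 < Gamma p" using p by (simp add: Gamma_real_pos)
  then have G0: "Gamma p \<noteq> 0" by linarith
  have eq: "gamma_rate_density p l x * x = gamma_rate_density p l x * x powr 1" for x
    by (cases "0 < x") (auto simp: gamma_rate_density_eq_0)
  have "p \<notin> \<int>\<^sub>\<le>\<^sub>0" using p by auto
  then have "Gamma (p + 1) / Gamma p * l powr (- 1) = p / l"
    using p G0 Gamma_plus1[of p] by (simp add: powr_minus field_simps)
  then have nn: "(\<integral>\<^sup>+x. ennreal (gamma_rate_density p l x * x) \<partial>lborel) = ennreal (p / l)"
    using p nn_integral_gamma_rate_density_powr[of p l 1] unfolding eq by simp
  have nonneg: "0 \<le> gamma_rate_density p l x * x" for x
    unfolding eq using p by (simp add: gamma_rate_density_nonneg)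
  show "integrable lborel (\<lambda>x. gamma_rate_density p l x * x)"
    using nn nonneg by (intro integrableI_nonneg) auto
  show "(\<integral>x. gamma_rate_density p l x * x \<partial>lborel) = p / l"
    using nn nonneg p by (subst integral_eq_nn_integral) auto
qed

section \<open>Entropy bounds for the weighted and for the equal-weight sum\<close>

context prob_space
begin

lemma entropy_exp_1_lborel:
  assumes D: "distributed M lborel S (\<lambda>x. ennreal (f x))" and nonneg: "\<And>x. 0 \<le> f x"
  shows "entropy (exp 1) lborel S = - (\<integral>x. f x * ln (f x) \<partial>lborel)"
proof -
  interpret information_space M "exp 1"
    by standard simp
  show ?thesis
    using entropy_distr[OF D] nonneg by (simp add: log_def)
qed

lemma distributed_nn_integral_1:
  assumes D: "distributed M lborel S (\<lambda>x. ennreal (f x))"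
  shows "(\<integral>\<^sup>+x. ennreal (f x) \<partial>lborel) = 1"
  using distributed_nn_integral[OF D, of "\<lambda>_. 1"] by (simp add: emeasure_space_1)

text \<open>Both bounds are Gibbs' inequality against a law with the mean \<open>a * s\<close> of
  the sum, where \<open>s\<close> is the sum of the weights: the Gamma law with shape
  \<open>k\<close> and rate \<open>s\<close>, and an exponential law.\<close>

lemma entropy_weighted_sum_gamma_le:
  fixes c :: "'i \<Rightarrow> real"
  assumes fin: "finite I" and a: "0 < a"
    and indep: "indep_vars (\<lambda>_. borel) X I"
    and D: "\<And>i. i \<in> I \<Longrightarrow> distributed M lborel (X i) (\<lambda>x. ennreal (gamma_density a x))"
    and c: "\<And>i. i \<in> I \<Longrightarrow> 0 < c i" and sq: "(\<Sum>i\<in>I. (c i)\<^sup>2) = 1"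
  defines "k \<equiv> a * (\<Sum>i\<in>I. c i)\<^sup>2"
  shows "1 \<le> k \<Longrightarrow>
      entropy (exp 1) lborel (\<lambda>\<omega>. \<Sum>i\<in>I. c i * X i \<omega>) \<le> gamma_std_entropy k + ln a / 2"
    and "entropy (exp 1) lborel (\<lambda>\<omega>. \<Sum>i\<in>I. c i * X i \<omega>) \<le> 1 + ln k / 2 + ln a / 2"
proof -
  define Y where "Y i \<omega> = c i * X i \<omega>" for i \<omega>
  define s where "s = (\<Sum>i\<in>I. c i)"
  have ne: "I \<noteq> {}" using sq by auto
  have s: "0 < s" unfolding s_def using fin ne c by (intro sum_pos) auto
  have k: "0 < k" and k_eq: "k = a * s\<^sup>2" using a s by (simp_all add: k_def s_def)
  \<comment> \<open>Weights of at most \<open>1\<close> make every rate \<open>1 / c i\<close> at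
    least \<open>1\<close>, so rate \<open>1\<close> serves for the dominating Gamma
    density.\<close>
  have c1: "c i \<le> 1" if "i \<in> I" for i
  proof -
    have "(c i)\<^sup>2 \<le> (\<Sum>i\<in>I. (c i)\<^sup>2)" using fin that by (intro member_le_sum) auto
    then show ?thesis using sq c[OF that] by (simp add: power2_le_iff_abs_le abs_square_le_1)
  qed
  have DY: "distributed M lborel (Y i) (\<lambda>x. ennreal (gamma_rate_density a (1 / c i) x))"
    if "i \<in> I" for i
    unfolding Y_def using that by (intro distributed_cmult_gamma_density D c)
  have indepY: "indep_vars (\<lambda>_. borel) Y I"
    unfolding Y_def[abs_def] by (rule indep_vars_compose2[OF indep]) simp
  have rate: "1 \<le> 1 / c i" if "i \<in> I" for i
    using c[OF that] c1[OF that] by simp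
  obtain f C where Df: "distributed M lborel (\<lambda>\<omega>. \<Sum>i\<in>I. Y i \<omega>) (\<lambda>x. ennreal (f x))"
    and f: "\<And>x. 0 \<le> f x" "\<And>x. f x \<le> C * gamma_rate_density (real (card I) * a) 1 x"
  proof -
    have "\<exists>f C. distributed M lborel (\<lambda>\<omega>. \<Sum>i\<in>I. Y i \<omega>) (\<lambda>x. ennreal (f x))
      \<and> (\<forall>x. 0 \<le> f x \<and> f x \<le> C * gamma_rate_density (real (card I) * a) 1 x) \<and> 0 \<le> C"
      using fin ne zero_less_one a indepY rate DY by (rule distributed_sum_le_gamma)
    then show ?thesis using that by blast
  qed
  have f_meas: "f \<in> borel_measurable borel"
    using distributed_real_measurable[OF f(1) Df] by simp
  have n: "0 < real (card I) * a" using fin ne a by (simp add: card_gt_0_iff)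
  note facts = f_meas f n zero_less_one distributed_nn_integral_1[OF Df]
  have H: "entropy (exp 1) lborel (\<lambda>\<omega>. \<Sum>i\<in>I. c i * X i \<omega>) = - (\<integral>x. f x * ln (f x) \<partial>lborel)"
    using entropy_exp_1_lborel[OF Df f(1)] by (simp add: Y_def)
  have mean: "(\<integral>x. f x * x \<partial>lborel) = a * s"
  proof -
    have Y1: "integrable M (Y i)" "expectation (Y i) = a * c i" if "i \<in> I" for i
      using distributed_integrable[OF DY[OF that], of "\<lambda>x. x"]
        distributed_integral[OF DY[OF that], of "\<lambda>x. x"] a c[OF that]
        integral_gamma_rate_density_mean[of a "1 / c i"]
      by (auto simp: gamma_rate_density_nonneg)
    have "(\<integral>x. f x * x \<partial>lborel) = expectation (\<lambda>\<omega>. \<Sum>i\<in>I. Y i \<omega>)"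
      using f by (intro distributed_integral[OF Df]) auto
    also have "\<dots> = (\<Sum>i\<in>I. a * c i)" using Y1 by simp
    finally show ?thesis by (simp add: s_def sum_distrib_left)
  qed
  \<comment> \<open>Independence factors the transform into Gamma transforms with rates
    \<open>1 / c i\<close>, which are then compared with a single Gamma transform.\<close>
  have laplace: "(\<integral>\<^sup>+x. ennreal (f x * exp (- (t * x))) \<partial>lborel) \<le> ennreal ((s / (s + t)) powr k)"
    if t: "0 < t" for t
  proof -
    have "(\<integral>\<^sup>+x. ennreal (f x * exp (- (t * x))) \<partial>lborel)
        = (\<integral>\<^sup>+x. ennreal (f x) * ennreal (exp (- (t * x))) \<partial>lborel)"
      using f by (simp add: ennreal_mult)
    also have "\<dots> = (\<integral>\<^sup>+\<omega>. ennreal (exp (- (t * (\<Sum>i\<in>I. Y i \<omega>)))) \<partial>M)"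
      by (rule distributed_nn_integral[OF Df]) simp
    also have "\<dots> = (\<integral>\<^sup>+\<omega>. (\<Prod>i\<in>I. ennreal (exp (- (t * Y i \<omega>)))) \<partial>M)"
      using fin by (simp add: prod_ennreal exp_sum sum_distrib_left flip: sum_negf)
    also have "\<dots> = (\<Prod>i\<in>I. \<integral>\<^sup>+\<omega>. ennreal (exp (- (t * Y i \<omega>))) \<partial>M)"
      using fin by (intro indep_vars_nn_integral indep_vars_compose2[OF indepY]) auto
    also have "\<dots> = (\<Prod>i\<in>I. ennreal ((1 / (1 + c i * t)) powr a))"
    proof (intro prod.cong refl)
      fix i assume i: "i \<in> I"
      have "(\<integral>\<^sup>+\<omega>. ennreal (exp (- (t * Y i \<omega>))) \<partial>M)
          = (\<integral>\<^sup>+x. ennreal (gamma_rate_density a (1 / c i) x) * ennreal (exp (- (t * x))) \<partial>lborel)"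
        by (rule distributed_nn_integral[OF DY[OF i], symmetric]) simp
      also have "\<dots> = ennreal (((1 / c i) / (1 / c i + t)) powr a)"
        using a c[OF i] t nn_integral_gamma_rate_density_exp[of a "1 / c i" t]
        by (simp add: gamma_rate_density_nonneg flip: ennreal_mult)
      also have "(1 / c i) / (1 / c i + t) = 1 / (1 + c i * t)"
        using c[OF i] t by (simp add: field_simps)
      finally show "(\<integral>\<^sup>+\<omega>. ennreal (exp (- (t * Y i \<omega>))) \<partial>M) = ennreal ((1 / (1 + c i * t)) powr a)" .
    qed
    also have "\<dots> = ennreal (\<Prod>i\<in>I. (1 / (1 + c i * t)) powr a)"
      by (rule prod_ennreal) simp
    also have "\<dots> \<le> ennreal ((s / (s + t)) powr k)"
      unfolding k_eq using fin c sq s t a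
      by (intro ennreal_leI prod_laplace_le) (auto simp: s_def less_imp_le)
    finally show ?thesis .
  qed
  have ln_k: "ln k = ln a + 2 * ln s" using a s by (simp add: k_eq ln_mult ln_realpow)
  show "entropy (exp 1) lborel (\<lambda>\<omega>. \<Sum>i\<in>I. c i * X i \<omega>) \<le> gamma_std_entropy k + ln a / 2"
    if k1: "1 \<le> k"
  proof -
    \<comment> \<open>The factor \<open>k - 1\<close> is nonnegative, so the lower bound on the
      logarithmic moment becomes an upper bound on the entropy.\<close>
    have "(k - 1) * (Digamma k - ln s) \<le> (k - 1) * (\<integral>x. f x * ln x \<partial>lborel)"
      using k1 k s laplace by (intro mult_left_mono integral_ln_ge_of_laplace_le[OF facts]) auto
    moreover have "- (\<integral>x. f x * ln (f x) \<partial>lborel) \<le> ln (Gamma k) - k * ln s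
      - (k - 1) * (\<integral>x. f x * ln x \<partial>lborel) + s * (a * s)"
      using le_gamma_entropy[OF facts k s] mean by simp
    ultimately have "- (\<integral>x. f x * ln (f x) \<partial>lborel) \<le> ln (Gamma k) - k * ln s
      - (k - 1) * (Digamma k - ln s) + s * (a * s)" by linarith
    also have "\<dots> = gamma_std_entropy k + ln a / 2"
    proof -
      have "s * (a * s) = k" by (simp add: k_eq power2_eq_square)
      then show ?thesis using ln_k by (simp add: gamma_std_entropy_def field_simps)
    qed
    finally show ?thesis by (simp add: H)
  qed
  \<comment> \<open>Shape \<open>1\<close> removes the logarithmic moment from Gibbs' inequality,
    and rate \<open>1 / (a * s)\<close> matches the mean.\<close>
  show "entropy (exp 1) lborel (\<lambda>\<omega>. \<Sum>i\<in>I. c i * X i \<omega>) \<le> 1 + ln k / 2 + ln a / 2"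
    using le_gamma_entropy[OF facts, of 1 "1 / (a * s)"] a s mean ln_k H
    by (simp add: ln_div ln_mult add_divide_distrib)
qed

text \<open>This sum is itself Gamma, with shape \<open>real n * a\<close> and rate
  \<open>sqrt (real n)\<close>, so its entropy is explicit up to the logarithmic moment. As the
  shape is at least \<open>1\<close>, an upper bound on that moment suffices.\<close>

lemma entropy_scaled_sum_gamma_ge:
  fixes n :: nat
  assumes a: "0 < a" and na: "1 \<le> real n * a"
    and indep: "indep_vars (\<lambda>_. borel) X {..<n}"
    and D: "\<And>i. i < n \<Longrightarrow> distributed M lborel (X i) (\<lambda>x. ennreal (gamma_density a x))"
  shows "gamma_std_entropy (real n * a) + ln a / 2
    \<le> entropy (exp 1) lborel (\<lambda>\<omega>. (1 / sqrt (real n)) * (\<Sum>i<n. X i \<omega>))"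
proof -
  have n: "0 < n" using na by (cases n) auto
  define k where "k = real n * a"
  define r where "r = sqrt (real n)"
  have k: "0 < k" "1 \<le> k" using na by (auto simp: k_def)
  have r: "0 < r" using n by (simp add: r_def)
  let ?g = "gamma_rate_density k r"
  let ?S = "\<lambda>\<omega>. \<Sum>i<n. (1 / r) * X i \<omega>"
  have indepY: "indep_vars (\<lambda>_. borel) (\<lambda>i \<omega>. (1 / r) * X i \<omega>) {..<n}"
    by (rule indep_vars_compose2[OF indep]) simp
  have "distributed M lborel (\<lambda>\<omega>. (1 / r) * X i \<omega>) (\<lambda>x. ennreal (gamma_rate_density a r x))"
    if "i \<in> {..<n}" for i
    using distributed_cmult_gamma_density[OF D, of i "1 / r"] that r by simp
  then have DS: "distributed M lborel ?S (\<lambda>x. ennreal (?g x))"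
    using distributed_sum_gamma[OF _ _ r a indepY] n by (simp add: k_def lessThan_empty_iff)
  have g: "\<And>x. 0 \<le> ?g x" "\<And>x. ?g x \<le> 1 * ?g x" using k by (auto simp: gamma_rate_density_nonneg)
  note facts = measurable_gamma_rate_density g k(1) r nn_integral_gamma_rate_density[OF k(1) r]
  have "(\<integral>x. ?g x * ln (?g x) \<partial>lborel)
      = (\<integral>x. (k * ln r - ln (Gamma k)) * ?g x + (k - 1) * (?g x * ln x) - r * (?g x * x) \<partial>lborel)"
  proof (intro Bochner_Integration.integral_cong refl)
    fix x
    show "?g x * ln (?g x) = (k * ln r - ln (Gamma k)) * ?g x + (k - 1) * (?g x * ln x) - r * (?g x * x)"
    proof (cases "0 < x")
      case True
      then show ?thesis
        unfolding ln_gamma_rate_density[OF k(1) r True] by (simp add: algebra_simps)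
    qed (simp add: gamma_rate_density_eq_0)
  qed
  also have "\<dots> = (k * ln r - ln (Gamma k)) + (k - 1) * (\<integral>x. ?g x * ln x \<partial>lborel) - r * (k / r)"
    using le_gamma_integrable[OF facts] le_gamma_integral[OF facts] le_gamma_integrable_ln[OF facts]
      integral_gamma_rate_density_mean[OF k(1) r] by simp
  also have "\<dots> \<le> (k * ln r - ln (Gamma k)) + (k - 1) * (Digamma k - ln r) - r * (k / r)"
    using k r by (intro diff_mono add_mono order_refl mult_left_mono integral_ln_gamma_rate_density_le) auto
  also have "\<dots> = - (gamma_std_entropy k + ln a / 2)"
  proof -
    have "ln k = ln a + 2 * ln r" using a n by (simp add: k_def r_def ln_mult ln_sqrt)
    then show ?thesis using r by (simp add: gamma_std_entropy_def algebra_simps)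
  qed
  finally show ?thesis
    using entropy_exp_1_lborel[OF DS g(1)] by (simp add: k_def r_def sum_distrib_left)
qed

end

section \<open>The equality case and the theorem\<close>

text \<open>Cauchy--Schwarz with its equality case, read off from the squared distance between
  \<open>d\<close> and the constant vector \<open>1 / sqrt (real n)\<close>.\<close>

lemma sum_squared_le_card:
  fixes d :: "nat \<Rightarrow> real"
  assumes sq: "(\<Sum>i<n. (d i)\<^sup>2) = 1" and s: "0 \<le> (\<Sum>i<n. d i)"
  shows "(\<Sum>i<n. d i)\<^sup>2 \<le> real n"
    and "(\<Sum>i<n. d i)\<^sup>2 = real n \<Longrightarrow> \<forall>i<n. d i = 1 / sqrt (real n)"
proof -
  have n: "0 < n" using sq by (cases n) auto
  let ?s = "\<Sum>i<n. d i"
  have eq: "(\<Sum>i<n. (d i - 1 / sqrt (real n))\<^sup>2) = 2 - 2 * ?s / sqrt (real n)"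
  proof -
    have "(\<Sum>i<n. (d i - 1 / sqrt (real n))\<^sup>2)
        = (\<Sum>i<n. (d i)\<^sup>2 - 2 / sqrt (real n) * d i + 1 / real n)"
      by (intro sum.cong) (auto simp: power2_diff power_divide)
    also have "\<dots> = 2 - 2 / sqrt (real n) * ?s"
      using n by (simp add: sum.distrib sum_subtractf sq flip: sum_distrib_left sum_divide_distrib)
    finally show ?thesis by simp
  qed
  have "0 \<le> (\<Sum>i<n. (d i - 1 / sqrt (real n))\<^sup>2)" by (intro sum_nonneg) simp
  then have "?s \<le> sqrt (real n)" using n unfolding eq by (simp add: field_simps)
  then show "?s\<^sup>2 \<le> real n" using s by (metis of_nat_0_le_iff power_mono real_sqrt_pow2)
  assume "?s\<^sup>2 = real n"
  then have "?s = sqrt (real n)" using s by (metis real_sqrt_unique)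
  then have "(\<Sum>i<n. (d i - 1 / sqrt (real n))\<^sup>2) = 0" using n unfolding eq by simp
  then show "\<forall>i<n. d i = 1 / sqrt (real n)" by (simp add: sum_nonneg_eq_0_iff)
qed

theorem theorem1:
  fixes M :: "'a measure" and X :: "nat \<Rightarrow> 'a \<Rightarrow> real"
    and a :: real and n :: nat and d :: "nat \<Rightarrow> real"
  assumes "prob_space M"
    and "a > 0"
    and "prob_space.indep_vars M (\<lambda>_. borel) X {..<n}"
    and "\<And>i. i < n \<Longrightarrow> distributed M lborel (X i) (\<lambda>x. ennreal (gamma_density a x))"
    and "real n \<ge> 1 / a"
    and "\<And>i. i < n \<Longrightarrow> d i \<ge> 0"
    and "(\<Sum>i<n. (d i)\<^sup>2) = 1"
  shows "prob_space.entropy M (exp 1) lborel (\<lambda>\<omega>. \<Sum>i<n. d i * X i \<omega>)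
           \<le> prob_space.entropy M (exp 1) lborel (\<lambda>\<omega>. (1 / sqrt (real n)) * (\<Sum>i<n. X i \<omega>))
       \<and> (prob_space.entropy M (exp 1) lborel (\<lambda>\<omega>. \<Sum>i<n. d i * X i \<omega>)
           = prob_space.entropy M (exp 1) lborel (\<lambda>\<omega>. (1 / sqrt (real n)) * (\<Sum>i<n. X i \<omega>))
          \<longleftrightarrow> (\<forall>i<n. d i = 1 / sqrt (real n)))"
proof -
  interpret prob_space M by fact
  let ?S = "\<lambda>\<omega>. \<Sum>i<n. d i * X i \<omega>"
  let ?Z = "\<lambda>\<omega>. (1 / sqrt (real n)) * (\<Sum>i<n. X i \<omega>)"
  show ?thesis
  \<comment> \<open>Equal weights make both sums the same function. For other weights a strict
    inequality gives both the bound and the equivalence.\<close>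
  proof (cases "\<forall>i<n. d i = 1 / sqrt (real n)")
    case True
    then have "?S = ?Z" by (simp add: sum_distrib_left)
    then show ?thesis using True by simp
  next
    case False
    \<comment> \<open>Zero weights are dropped, since \<open>0 * X i\<close> has no density.\<close>
    define I where "I = {i. i < n \<and> 0 < d i}"
    define s where "s = (\<Sum>i\<in>I. d i)"
    have d0: "d i = 0" if "i \<in> {..<n} - I" for i
      using that assms(6)[of i] by (auto simp: I_def)
    have I: "finite I" "I \<subseteq> {..<n}" by (auto simp: I_def)
    have s_eq: "(\<Sum>i<n. d i) = s"
      unfolding s_def using I d0 by (intro sum.mono_neutral_right) auto
    have sq: "(\<Sum>i\<in>I. (d i)\<^sup>2) = 1"
      unfolding assms(7)[symmetric] using I d0 by (intro sum.mono_neutral_left) auto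
    have S_eq: "?S = (\<lambda>\<omega>. \<Sum>i\<in>I. d i * X i \<omega>)"
      using I d0 by (intro ext sum.mono_neutral_right) auto
    have "I \<noteq> {}" using sq by auto
    then have s: "0 < s" unfolding s_def using I(1) by (intro sum_pos) (auto simp: I_def)
    have "0 \<le> (\<Sum>i<n. d i)" using s s_eq by simp
    note le_n = sum_squared_le_card[OF assms(7) this, unfolded s_eq]
    \<comment> \<open>Strictness of the whole inequality comes from here, by the equality case of
      Cauchy--Schwarz.\<close>
    have "s\<^sup>2 < real n" using le_n False by (meson less_le)
    then have lt: "a * s\<^sup>2 < real n * a" using \<open>a > 0\<close> by simp
    have na: "1 \<le> real n * a" using assms(2,5) by (simp add: field_simps)
    have Z: "gamma_std_entropy (real n * a) + ln a / 2 \<le> entropy (exp 1) lborel ?Z"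
      using assms(2-4) na by (intro entropy_scaled_sum_gamma_ge) auto
    have DI: "distributed M lborel (X i) (\<lambda>x. ennreal (gamma_density a x))" if "i \<in> I" for i
      using that by (intro assms(4)) (simp add: I_def)
    have dI: "0 < d i" if "i \<in> I" for i using that by (simp add: I_def)
    note S = entropy_weighted_sum_gamma_le[OF I(1) assms(2) indep_vars_subset[OF assms(3) I(2)]
        DI dI sq, folded s_def S_eq]
    have "entropy (exp 1) lborel ?S < gamma_std_entropy (real n * a) + ln a / 2"
    proof (cases "1 \<le> a * s\<^sup>2")
      case True
      then show ?thesis using S(1) gamma_std_entropy_strict_mono[OF True lt] by linarith
    next
      case False
      \<comment> \<open>The exponential bound is now below \<open>1 + ln a / 2\<close>, and
        \<open>gamma_std_entropy 1 = 1\<close> is the least value for shapes from \<open>1\<close>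
        on.\<close>
      then have "ln (a * s\<^sup>2) < 0" using assms(2) s by (intro ln_less_zero) auto
      moreover have "1 \<le> gamma_std_entropy (real n * a)"
        using gamma_std_entropy_strict_mono[of 1 "real n * a"] na
        by (cases "real n * a = 1") (auto simp: gamma_std_entropy_def)
      ultimately show ?thesis using S(2) by linarith
    qed
    then show ?thesis using Z False by auto
  qed
qed

end
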